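(* Let $G$ be a connected locally finite graph and let $H$ be a connected finite graph with at least one edge. Then the lamplighter graph $G \wr H$ (formed with respect to any reference state $s_0\in V(H)$) does not admit any non-constant harmonic function of finite Dirichlet energy; that is, every harmonic function $\phi: V(G\wr H)\to\mathbb{R}$ with finite Dirichlet energy $W(\phi)<\infty$ is constant.
   Context: Graphs are simple and undirected. A graph is locally finite if every vertex has finite degree. Lamplighter graph: let $G,H$ be connected graphs and fix a vertex $s_0\in V(H)$. The vertex set of $G\wr H$ is the set of pairs $(C,x)$ where $C:V(G)\to V(H)$ is a function such that $C(v)\neq s_0$ for only finitely many $v\in V(G)$, and $x\in V(G)$. Two vertices $(C,x)$ and $(C',x')$ of $G\wr H$ are joined by an edge if and only if (precisely) one of the following holds: (i) $C=C'$ and $xx'\in E(G)$; or (ii) $x=x'$, $C(v)=C'(v)$ for all $v\in V(G)\setminus\{x\}$, and $C(x)C'(x)\in E(H)$. Harmonic function: for a locally finite graph $\Gamma$, a function $\phi:V(\Gamma)\to\mathbb{R}$ is harmonic if for every $x\in V(\Gamma)$ we have $\phi(x)=\frac{1}{d(x)}\sum_{xy\in E(\Gamma)}\phi(y)$, where $d(x)$ is the number of edges incident with $x$. Dirichlet energy: $W(\phi):=\sum_{uv\in E(\Gamma)}(\phi(u)-\phi(v))^2$, the sum being over all (undirected) edges of $\Gamma$. *)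

theory Defs
  imports
    "HOL-Analysis.Analysis"
    "Graph_Theory.Pair_Digraph"
    "Graph_Theory.Digraph_Component"
begin

text \<open>
  A simple undirected graph, finite or infinite, is a \<^locale>\<open>pair_bidirected_digraph\<close>: an edge
  \<open>uv\<close> is represented by the two arcs \<open>(u, v)\<close> and \<open>(v, u)\<close>, and there are no loops. The
  finite ones are the \<^locale>\<open>pair_graph\<close>s. The edges incident with a vertex correspond to its
  outgoing arcs, so that the degree is \<^const>\<open>out_degree\<close>.
\<close>

definition locally_finite :: "'a pair_pre_digraph \<Rightarrow> bool" where
  "locally_finite G \<longleftrightarrow> (\<forall>x \<in> pverts G. finite (out_arcs (with_proj G) x))"

text \<open>
  Functions \<open>V(G) \<rightarrow> V(H)\<close> are represented by the extensional function space, so that two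
  configurations that agree on \<open>V(G)\<close> are equal.
\<close>

definition lamplighter_verts ::
  "'a pair_pre_digraph \<Rightarrow> 'b pair_pre_digraph \<Rightarrow> 'b \<Rightarrow> (('a \<Rightarrow> 'b) \<times> 'a) set" where
  "lamplighter_verts G H s0 =
     {(C, x). C \<in> pverts G \<rightarrow>\<^sub>E pverts H \<and> finite {v \<in> pverts G. C v \<noteq> s0} \<and> x \<in> pverts G}"

definition lamplighter ::
  "'a pair_pre_digraph \<Rightarrow> 'b pair_pre_digraph \<Rightarrow> 'b \<Rightarrow> (('a \<Rightarrow> 'b) \<times> 'a) pair_pre_digraph" where
  "lamplighter G H s0 =
     \<lparr> pverts = lamplighter_verts G H s0,
       parcs = {((C, x), (C', x')).
         (C, x) \<in> lamplighter_verts G H s0 \<and> (C', x') \<in> lamplighter_verts G H s0 \<and>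
         (C = C' \<and> (x, x') \<in> parcs G \<or>
          x = x' \<and> (\<forall>v \<in> pverts G - {x}. C v = C' v) \<and> (C x, C' x) \<in> parcs H)} \<rparr>"

definition harmonic :: "'a pair_pre_digraph \<Rightarrow> ('a \<Rightarrow> real) \<Rightarrow> bool" where
  "harmonic G \<phi> \<longleftrightarrow>
     (\<forall>x \<in> pverts G.
        \<phi> x = 1 / real (out_degree (with_proj G) x) * (\<Sum>y | (x, y) \<in> parcs G. \<phi> y))"

text \<open>
  The sum is over arcs, so every undirected edge is counted twice; hence the factor \<open>1/2\<close>.
  It is taken in \<^typ>\<open>ennreal\<close>, where it always exists and equals \<open>\<infinity>\<close> if the
  series diverges.
\<close>

definition dirichlet_energy :: "'a pair_pre_digraph \<Rightarrow> ('a \<Rightarrow> real) \<Rightarrow> ennreal" where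
  "dirichlet_energy G \<phi> = (\<Sum>\<^sub>\<infinity>(u, v) \<in> parcs G. ennreal ((\<phi> u - \<phi> v)\<^sup>2)) / 2"

lemma pair_bidirected_digraph_lamplighter:
  assumes "pair_bidirected_digraph G" "pair_bidirected_digraph H"
  shows "pair_bidirected_digraph (lamplighter G H s0)"
proof -
  interpret G: pair_bidirected_digraph G by fact
  interpret H: pair_bidirected_digraph H by fact
  have symG: "(y, x) \<in> parcs G" if "(x, y) \<in> parcs G" for x y
    using G.pair_sym_arcs that by (auto simp: symmetric_def dest: symD)
  have symH: "(y, x) \<in> parcs H" if "(x, y) \<in> parcs H" for x y
    using H.pair_sym_arcs that by (auto simp: symmetric_def dest: symD)
  show ?thesis
  proof
    show "symmetric (with_proj (lamplighter G H s0))"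
      unfolding symmetric_def by (rule symI) (auto simp: lamplighter_def intro: symG symH)
  next
    fix e assume "e \<in> parcs (lamplighter G H s0)"
    then show "fst e \<noteq> snd e"
      using G.pair_no_loops H.pair_no_loops by (fastforce simp: lamplighter_def)
  qed (auto simp: lamplighter_def)
qed

lemma locally_finite_lamplighter:
  assumes "locally_finite G" "finite (pverts H)"
  shows "locally_finite (lamplighter G H s0)"
  unfolding locally_finite_def
proof
  fix z assume "z \<in> pverts (lamplighter G H s0)"
  then obtain C x where z: "z = (C, x)" "x \<in> pverts G"
    by (auto simp: lamplighter_def lamplighter_verts_def)
  let ?A = "(\<lambda>e. (z, (C, snd e))) ` out_arcs (with_proj G) x"
  let ?B = "(\<lambda>s. (z, (C(x := s), x))) ` pverts H"
  have "out_arcs (with_proj (lamplighter G H s0)) z \<subseteq> ?A \<union> ?B"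
  proof
    fix e assume "e \<in> out_arcs (with_proj (lamplighter G H s0)) z"
    then obtain C' x' where e: "e = (z, (C', x'))" "((C, x), (C', x')) \<in> parcs (lamplighter G H s0)"
      using z by (cases e) (auto simp: out_arcs_def)
    then consider "C = C'" "(x, x') \<in> parcs G"
      | "x = x'" "\<forall>v \<in> pverts G - {x}. C v = C' v"
      by (auto simp: lamplighter_def)
    then show "e \<in> ?A \<union> ?B"
    proof cases
      case 1
      then show ?thesis using e by (force simp: out_arcs_def)
    next
      case 2
      have C: "C \<in> pverts G \<rightarrow>\<^sub>E pverts H" "C' \<in> pverts G \<rightarrow>\<^sub>E pverts H"
        using e by (auto simp: lamplighter_def lamplighter_verts_def)
      have "C' v = (C(x := C' x)) v" for v
        using 2(2) C by (cases "v \<in> pverts G") (auto simp: PiE_def extensional_def)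
      then have "C' = C(x := C' x)" by blast
      moreover have "C' x \<in> pverts H" using C z by auto
      ultimately show ?thesis using e 2(1) by blast
    qed
  qed
  moreover have "finite (?A \<union> ?B)"
    using assms z by (auto simp: locally_finite_def)
  ultimately show "finite (out_arcs (with_proj (lamplighter G H s0)) z)"
    by (rule finite_subset)
qed

end

theory Submission
  imports Defs
begin

text \<open>
  A function \<open>\<phi>\<close> of finite energy on the lamplighter graph, harmonic or not, converges to a constant
  at infinity: outside a finite set of vertices its values differ by at most \<open>\<epsilon>\<close>. For a harmonic
  function the maximum principle then forces \<open>\<phi>\<close> to be constant.

  For the convergence, let the lamplighter start at \<open>(C, x)\<close>, walk along an injective path of length
  \<open>N\<close> in \<open>G\<close>, and randomize each lamp uniformly before leaving it. After \<open>i\<close> steps the walker is spread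
  evenly over at least \<open>2 ^ i\<close> configurations, so by Cauchy--Schwarz the mean of \<open>\<phi>\<close> changes in the next
  step by at most a constant times \<open>sqrt (E i / 2 ^ i)\<close>, where \<open>E i\<close> is the energy of the arcs in use.
  If \<open>(C, x)\<close> is far out, the early steps avoid the finitely many arcs that carry most of the energy,
  while the late ones are damped by \<open>2 ^ i\<close>; the total change is small. From there a tour of \<open>O(N)\<close>
  further steps, each costing at most \<open>O(2 ^ (- N / 2))\<close>, randomizes any other finite set of lamps.
  Hence two starting points \<open>(C, x)\<close> and \<open>(C', y)\<close> can be led to the same distribution: both randomize
  the two long paths and all lamps in which \<open>C\<close> and \<open>C'\<close> differ.
\<close>

section \<open>Harmonic functions and the maximum principle\<close>

lemma connected_imp_rtrancl:
  assumes "pair_bidirected_digraph G" "Digraph_Component.connected (with_proj G)"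
    and "x \<in> pverts G" "y \<in> pverts G"
  shows "(x, y) \<in> (parcs G)\<^sup>*"
proof -
  interpret pair_bidirected_digraph G by fact
  have "(x, y) \<in> rtrancl_on (pverts G) (parcs G)"
    using assms(2-4) reachable_mk_symmetric_eq[OF pair_sym_arcs]
    by (auto simp: connected_def strongly_connected_def reachable_def)
  then show ?thesis by (rule rtrancl_on_rtranclI)
qed

lemma finite_neighbours:
  assumes "locally_finite G" "x \<in> pverts G"
  shows "finite {y. (x, y) \<in> parcs G}"
proof -
  have "{y. (x, y) \<in> parcs G} = snd ` out_arcs (with_proj G) x"
    by (force simp: out_arcs_def)
  then show ?thesis using assms by (simp add: locally_finite_def)
qed

lemma out_degree_eq_card_neighbours:
  "out_degree (with_proj G) x = card {y. (x, y) \<in> parcs G}"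
proof -
  have "out_arcs (with_proj G) x = Pair x ` {y. (x, y) \<in> parcs G}"
    by (auto simp: out_arcs_def)
  then show ?thesis
    by (simp add: out_degree_def card_image inj_on_def)
qed

text \<open>The nonnegative differences \<open>\<phi> a - \<phi> y\<close> over the neighbours
  \<open>y\<close> of \<open>a\<close> sum to 0, so each of them vanishes.\<close>

lemma harmonic_max_neighbour:
  assumes "locally_finite G" "harmonic G \<phi>" "parcs G \<subseteq> pverts G \<times> pverts G"
    and a: "a \<in> pverts G" and max: "\<And>b. b \<in> pverts G \<Longrightarrow> \<phi> b \<le> \<phi> a"
    and b: "(a, b) \<in> parcs G"
  shows "\<phi> b = \<phi> a"
proof -
  let ?N = "{y. (a, y) \<in> parcs G}"
  have fin: "finite ?N" using finite_neighbours assms(1) a .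
  \<comment> \<open>The neighbour \<open>b\<close> makes the degree positive, so the mean value
    identity is not about the default value of division by 0.\<close>
  have "card ?N > 0" using fin b by (auto simp: card_gt_0_iff)
  moreover have "\<phi> a = 1 / real (card ?N) * (\<Sum>y\<in>?N. \<phi> y)"
    using assms(2) a by (simp add: harmonic_def out_degree_eq_card_neighbours)
  ultimately have "(\<Sum>y\<in>?N. \<phi> a - \<phi> y) = 0"
    by (simp add: sum_subtractf field_simps)
  moreover have "\<phi> a - \<phi> y \<ge> 0" if "y \<in> ?N" for y
    using max[of y] that assms(3) by auto
  ultimately have "\<forall>y\<in>?N. \<phi> a - \<phi> y = 0"
    using sum_nonneg_eq_0_iff[OF fin, of "\<lambda>y. \<phi> a - \<phi> y"] by simp
  then show ?thesis using b by auto
qed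

lemma harmonic_max_constant:
  assumes "locally_finite G" "harmonic G \<phi>" "parcs G \<subseteq> pverts G \<times> pverts G"
    and conn: "\<And>a b. a \<in> pverts G \<Longrightarrow> b \<in> pverts G \<Longrightarrow> (a, b) \<in> (parcs G)\<^sup>*"
    and a: "a \<in> pverts G" and max: "\<And>b. b \<in> pverts G \<Longrightarrow> \<phi> b \<le> \<phi> a"
    and b: "b \<in> pverts G"
  shows "\<phi> b = \<phi> a"
proof -
  have "(a, b) \<in> (parcs G)\<^sup>*" using conn a b .
  then show ?thesis
  proof induction
    case (step y z)
    have "y \<in> pverts G" using step assms(3) by auto
    then have "\<phi> z = \<phi> y"
      by (rule harmonic_max_neighbour[OF assms(1-3) _ _ step(2)]) (simp add: max step.IH)
    then show ?case using step by simp
  qed simp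
qed

lemma harmonic_uminus:
  assumes "harmonic G \<phi>"
  shows "harmonic G (\<lambda>x. - \<phi> x)"
  unfolding harmonic_def
proof
  fix x assume "x \<in> pverts G"
  then have "\<phi> x = 1 / real (out_degree (with_proj G) x) * (\<Sum>y | (x, y) \<in> parcs G. \<phi> y)"
    using assms by (simp add: harmonic_def)
  then show "- \<phi> x = 1 / real (out_degree (with_proj G) x) * (\<Sum>y | (x, y) \<in> parcs G. - \<phi> y)"
    by (simp add: sum_negf)
qed

text \<open>The maximum over the finite set \<open>insert u (F \<inter> pverts G)\<close> dominates
  \<open>\<phi> u\<close>, hence every value off \<open>F\<close>. It is a global maximum, so
  \<open>\<phi>\<close> is constant, against \<open>\<phi> v < \<phi> u\<close>.\<close>

lemma harmonic_not_above_infinity: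
  assumes "locally_finite G" "harmonic G \<phi>" "parcs G \<subseteq> pverts G \<times> pverts G"
    and conn: "\<And>a b. a \<in> pverts G \<Longrightarrow> b \<in> pverts G \<Longrightarrow> (a, b) \<in> (parcs G)\<^sup>*"
    and u: "u \<in> pverts G" and v: "v \<in> pverts G" and "\<phi> v < \<phi> u"
    and F: "finite F" "\<And>w. w \<in> pverts G - F \<Longrightarrow> \<phi> w \<le> \<phi> u"
  shows False
proof -
  let ?F = "insert u (F \<inter> pverts G)"
  have fin: "finite (\<phi> ` ?F)" using F by simp
  then have "Max (\<phi> ` ?F) \<in> \<phi> ` ?F" by (rule Max_in) simp
  then obtain m where m': "m \<in> ?F" "Max (\<phi> ` ?F) = \<phi> m" by blast
  have m: "m \<in> ?F" "\<And>w. w \<in> ?F \<Longrightarrow> \<phi> w \<le> \<phi> m"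
    using m' Max_ge[OF fin] by auto
  have "m \<in> pverts G" using m(1) u by auto
  moreover have "\<phi> w \<le> \<phi> m" if "w \<in> pverts G" for w
    using m(2)[of w] m(2)[of u] F(2)[of w] that by force
  ultimately have "\<phi> u = \<phi> m" "\<phi> v = \<phi> m"
    using harmonic_max_constant[OF assms(1-4)] u v by blast+
  then show False using \<open>\<phi> v < \<phi> u\<close> by simp
qed

lemma harmonic_convergent_at_infinity_constant:
  assumes "locally_finite G" "harmonic G \<phi>" "parcs G \<subseteq> pverts G \<times> pverts G"
    and conn: "\<And>a b. a \<in> pverts G \<Longrightarrow> b \<in> pverts G \<Longrightarrow> (a, b) \<in> (parcs G)\<^sup>*"
    and conv: "\<And>\<epsilon>. \<epsilon> > 0 \<Longrightarrow>
      \<exists>F. finite F \<and> (\<forall>u \<in> pverts G - F. \<forall>v \<in> pverts G - F. \<bar>\<phi> u - \<phi> v\<bar> \<le> \<epsilon>)"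
  shows "\<phi> constant_on pverts G"
proof -
  have False if u: "u \<in> pverts G" and v: "v \<in> pverts G" and less: "\<phi> v < \<phi> u" for u v
  proof -
    \<comment> \<open>Off \<open>F\<close> the values differ by at most the gap
      \<open>\<phi> u - \<phi> v\<close>. Either none of them exceeds \<open>\<phi> u\<close>, or
      one does and then all of them lie above \<open>\<phi> v\<close>; the second case is the first
      one for \<open>- \<phi>\<close>.\<close>
    obtain F where F: "finite F"
      "\<And>w w'. w \<in> pverts G - F \<Longrightarrow> w' \<in> pverts G - F \<Longrightarrow> \<bar>\<phi> w - \<phi> w'\<bar> \<le> \<phi> u - \<phi> v"
      using conv[of "\<phi> u - \<phi> v"] less by auto
    consider "\<And>w. w \<in> pverts G - F \<Longrightarrow> \<phi> w \<le> \<phi> u"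
      | w where "w \<in> pverts G - F" "\<phi> w > \<phi> u"
      by fastforce
    then show False
    proof cases
      case 1
      then show ?thesis
        using harmonic_not_above_infinity[OF assms(1-4) u v less F(1)] by blast
    next
      case 2
      have "- \<phi> w' \<le> - \<phi> v" if "w' \<in> pverts G - F" for w'
        using F(2)[OF 2(1) that] 2(2) by linarith
      then show ?thesis
        using harmonic_not_above_infinity[OF assms(1) harmonic_uminus[OF assms(2)] assms(3,4) v u _ F(1)]
          less by simp
    qed
  qed
  then have "\<phi> u = \<phi> v" if "u \<in> pverts G" "v \<in> pverts G" for u v
    using that by (meson linorder_neqE)
  then show ?thesis unfolding constant_on_def by blast
qed

section \<open>Tails of the energy\<close>

text \<open>If the sum over \<open>E\<close> is within \<open>\<delta>\<close> of the supremum, a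
  finite set disjoint from \<open>E\<close> can add at most \<open>\<delta>\<close>.\<close>

lemma finite_sums_tail:
  fixes f :: "'a \<Rightarrow> real"
  assumes bound: "\<And>Y. finite Y \<Longrightarrow> Y \<subseteq> A \<Longrightarrow> sum f Y \<le> W" and "\<delta> > 0"
  shows "\<exists>E. finite E \<and> E \<subseteq> A \<and> (\<forall>Y. finite Y \<longrightarrow> Y \<subseteq> A - E \<longrightarrow> sum f Y \<le> \<delta>)"
proof -
  let ?S = "sum f ` {Y. finite Y \<and> Y \<subseteq> A}"
  have ne: "?S \<noteq> {}" by blast
  have bdd: "bdd_above ?S" using bound by (auto intro!: bdd_aboveI[of _ W])
  obtain E where E: "finite E" "E \<subseteq> A" "Sup ?S - \<delta> < sum f E"
    using less_cSupD[OF ne, of "Sup ?S - \<delta>"] \<open>\<delta> > 0\<close> by auto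
  have "sum f Y \<le> \<delta>" if Y: "finite Y" "Y \<subseteq> A - E" for Y
  proof -
    have "sum f (E \<union> Y) \<le> Sup ?S" using E Y by (intro cSup_upper bdd) auto
    moreover have "sum f (E \<union> Y) = sum f E + sum f Y"
      using E Y by (intro sum.union_disjoint) auto
    ultimately show ?thesis using E(3) by linarith
  qed
  then show ?thesis using E by blast
qed

text \<open>The bound is the sum over all arcs, that is, twice the Dirichlet energy.\<close>

lemma finite_energy_bounded_sums:
  assumes "dirichlet_energy G \<phi> < \<infinity>"
  obtains W where "\<And>Y. finite Y \<Longrightarrow> Y \<subseteq> parcs G \<Longrightarrow> (\<Sum>(u, v)\<in>Y. (\<phi> u - \<phi> v)\<^sup>2) \<le> W"
proof -
  let ?I = "\<Sum>\<^sub>\<infinity>(u, v) \<in> parcs G. ennreal ((\<phi> u - \<phi> v)\<^sup>2)"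
  have fin: "?I < \<infinity>"
    using assms by (auto simp: dirichlet_energy_def less_top[symmetric] ennreal_divide_eq_top_iff)
  have "(\<Sum>(u, v)\<in>Y. (\<phi> u - \<phi> v)\<^sup>2) \<le> enn2real ?I" if "finite Y" "Y \<subseteq> parcs G" for Y
  proof -
    have "ennreal (\<Sum>(u, v)\<in>Y. (\<phi> u - \<phi> v)\<^sup>2) = (\<Sum>(u, v)\<in>Y. ennreal ((\<phi> u - \<phi> v)\<^sup>2))"
      by (subst sum_ennreal[symmetric]) (auto simp: case_prod_unfold)
    also have "\<dots> \<le> ?I" unfolding infsum_finite[OF that(1), symmetric] using that
      by (intro infsum_mono_neutral nonneg_summable_on_complete) auto
    finally have "ennreal (\<Sum>(u, v)\<in>Y. (\<phi> u - \<phi> v)\<^sup>2) \<le> ennreal (enn2real ?I)"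
      using fin by simp
    then show ?thesis by (simp add: ennreal_le_iff)
  qed
  then show ?thesis using that by blast
qed

section \<open>Injective paths in infinite locally finite graphs\<close>

lemma finite_relpow_image:
  assumes "\<And>x. x \<in> V \<Longrightarrow> finite {y. (x, y) \<in> R}" "R \<subseteq> V \<times> V" "x \<in> V"
  shows "finite {y. (x, y) \<in> R ^^ n}"
proof (induction n)
  case (Suc n)
  have "{y. (x, y) \<in> R ^^ Suc n} \<subseteq> (\<Union>z \<in> {z. (x, z) \<in> R ^^ n} \<inter> V. {y. (z, y) \<in> R})"
    using assms(2) by auto
  then show ?case by (rule finite_subset) (use Suc assms(1) in auto)
qed simp

text \<open>Balls are finite, so the infinite set \<open>V\<close> has a vertex at distance more
  than \<open>N\<close> from \<open>x\<close>; a geodesic to it has no repetitions.\<close>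

lemma long_injective_path:
  assumes "\<And>x. x \<in> V \<Longrightarrow> finite {y. (x, y) \<in> R}" "R \<subseteq> V \<times> V" "infinite V" "x \<in> V"
    and conn: "\<And>y. y \<in> V \<Longrightarrow> (x, y) \<in> R\<^sup>*"
  obtains p where "p 0 = x" "inj_on p {..N}" "\<And>i. i < N \<Longrightarrow> (p i, p (Suc i)) \<in> R"
proof -
  have "finite (\<Union>n\<le>N. {y. (x, y) \<in> R ^^ n})"
    using finite_relpow_image[OF assms(1,2,4)] by auto
  then have "\<not> V \<subseteq> (\<Union>n\<le>N. {y. (x, y) \<in> R ^^ n})"
    using assms(3) finite_subset by blast
  then obtain y where y: "y \<in> V" "\<And>n. n \<le> N \<Longrightarrow> (x, y) \<notin> R ^^ n" by auto
  define m where "m = (LEAST m. (x, y) \<in> R ^^ m)"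
  have ex: "\<exists>m. (x, y) \<in> R ^^ m" using conn[OF y(1)] by (simp add: rtrancl_power)
  then have m: "(x, y) \<in> R ^^ m" unfolding m_def by (rule LeastI_ex)
  have least: "m \<le> k" if "(x, y) \<in> R ^^ k" for k unfolding m_def using that by (rule Least_le)
  have "N < m" using y(2)[of m] m by force
  obtain p where p: "p 0 = x" "p m = y" "\<And>i. i < m \<Longrightarrow> (p i, p (Suc i)) \<in> R"
    using m by (auto simp: relpow_fun_conv)
  \<comment> \<open>Cutting out the piece between two equal vertices would give a walk shorter than
    \<open>m\<close>.\<close>
  have neq: "p i \<noteq> p j" if "i < j" "j \<le> m" for i j
  proof
    assume eq: "p i = p j"
    have "(p 0, p i) \<in> R ^^ i" using p that by (auto simp: relpow_fun_conv)
    moreover have "(p j, p m) \<in> R ^^ (m - j)"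
      using p that by (auto simp: relpow_fun_conv intro!: exI[of _ "\<lambda>k. p (j + k)"])
    ultimately have "(x, y) \<in> R ^^ (i + (m - j))"
      using p eq by (auto simp: relpow_add)
    then show False using least that by fastforce
  qed
  have "inj_on p {..N}"
    using neq \<open>N < m\<close> by (intro inj_onI) (metis atMost_iff linorder_neqE_nat order.strict_implies_order order.strict_trans1)
  then show ?thesis using that p \<open>N < m\<close> by auto
qed

section \<open>Connectedness of the lamplighter graph\<close>

locale lamplighter_graph =
  fixes G :: "'a pair_pre_digraph" and H :: "'b pair_pre_digraph" and s0 :: 'b
  assumes bidirected_G: "pair_bidirected_digraph G"
    and connected_G: "Digraph_Component.connected (with_proj G)"
    and locally_finite_G: "locally_finite G"
    and graph_H: "pair_graph H"
    and connected_H: "Digraph_Component.connected (with_proj H)"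
    and edge_H: "parcs H \<noteq> {}"
begin

abbreviation "L \<equiv> lamplighter G H s0"
abbreviation "VG \<equiv> pverts G"
abbreviation "VH \<equiv> pverts H"

interpretation G: pair_bidirected_digraph G by (rule bidirected_G)
interpretation H: pair_graph H by (rule graph_H)

lemma bidirected_H: "pair_bidirected_digraph H"
  by unfold_locales

lemma sym_G: "(x, y) \<in> parcs G \<Longrightarrow> (y, x) \<in> parcs G"
  using G.pair_sym_arcs by (auto simp: symmetric_def dest: symD)

lemma G_sub: "parcs G \<subseteq> VG \<times> VG"
  using G.in_arcsD1 G.in_arcsD2 by auto

lemma H_sub: "parcs H \<subseteq> VH \<times> VH"
  using H.in_arcsD1 H.in_arcsD2 by auto

lemma finite_VH: "finite VH" by (rule H.pair_finite_verts)

text \<open>The two ends of an edge are distinct. Hence each further random lamp at least doubles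
  the number of configurations, which is the source of all decay below.\<close>

lemma card_VH: "2 \<le> card VH"
proof -
  obtain s t where st: "(s, t) \<in> parcs H" using edge_H by auto
  then have "s \<noteq> t" using H.pair_no_loops by fastforce
  moreover have "{s, t} \<subseteq> VH" using st H_sub by auto
  ultimately show ?thesis using card_mono[OF finite_VH, of "{s, t}"] by simp
qed

section \<open>Vertices, arcs and paths of the lamplighter graph\<close>

lemma L_sub: "parcs L \<subseteq> pverts L \<times> pverts L"
  by (auto simp: lamplighter_def)

lemma L_move:
  assumes "(C, x) \<in> pverts L" "(x, y) \<in> parcs G"
  shows "((C, x), (C, y)) \<in> parcs L"
  using assms G_sub by (auto simp: lamplighter_def lamplighter_verts_def)

lemma L_upd:
  assumes "(C, x) \<in> pverts L" "y \<in> VG" "t \<in> VH"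
  shows "(C(y := t), x) \<in> pverts L"
proof -
  have "{v \<in> VG. (C(y := t)) v \<noteq> s0} \<subseteq> insert y {v \<in> VG. C v \<noteq> s0}" by auto
  then have "finite {v \<in> VG. (C(y := t)) v \<noteq> s0}"
    by (rule finite_subset) (use assms in \<open>auto simp: lamplighter_def lamplighter_verts_def\<close>)
  then show ?thesis
    using assms by (auto simp: lamplighter_def lamplighter_verts_def extensional_def PiE_def Pi_def)
qed

lemma L_switch:
  assumes "(C, x) \<in> pverts L" "(C x, t) \<in> parcs H"
  shows "((C, x), (C(x := t), x)) \<in> parcs L"
proof -
  have "x \<in> VG" "t \<in> VH" using assms H_sub by (auto simp: lamplighter_def lamplighter_verts_def)
  then show ?thesis using L_upd[OF assms(1), of x t] assms by (auto simp: lamplighter_def)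
qed

lemma L_connected_position:
  assumes "(C, x) \<in> pverts L" "y \<in> VG"
  shows "((C, x), (C, y)) \<in> (parcs L)\<^sup>*"
proof -
  have x: "x \<in> VG" using assms by (auto simp: lamplighter_def lamplighter_verts_def)
  have "(x, y) \<in> (parcs G)\<^sup>*"
    using connected_imp_rtrancl[OF bidirected_G connected_G x assms(2)] .
  then show ?thesis
  proof induction
    case (step y z)
    have "(C, y) \<in> pverts L"
      using step(2) G_sub assms by (auto simp: lamplighter_def lamplighter_verts_def)
    then show ?case using L_move step by (metis rtrancl.rtrancl_into_rtrancl)
  qed simp
qed

lemma L_connected_lamp:
  assumes "(C, x) \<in> pverts L" "t \<in> VH"
  shows "((C, x), (C(x := t), x)) \<in> (parcs L)\<^sup>*"
proof -
  have x: "x \<in> VG" "C x \<in> VH" using assms by (auto simp: lamplighter_def lamplighter_verts_def)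
  have "(C x, t) \<in> (parcs H)\<^sup>*"
    using connected_imp_rtrancl[OF bidirected_H connected_H x(2) assms(2)] .
  then show ?thesis
  proof induction
    case (step s t)
    have "s \<in> VH" using step(2) H_sub by auto
    then have "(C(x := s), x) \<in> pverts L" using L_upd assms x by auto
    from L_switch[OF this, of t] step
    have "((C(x := s), x), (C(x := t), x)) \<in> parcs L" by simp
    with step.IH show ?case by (rule rtrancl.rtrancl_into_rtrancl)
  qed simp
qed

lemma L_connected:
  assumes "a \<in> pverts L" "b \<in> pverts L"
  shows "(a, b) \<in> (parcs L)\<^sup>*"
proof -
  obtain C x where a: "a = (C, x)" by force
  obtain C' y where b: "b = (C', y)" by force
  have fin: "finite {v \<in> VG. C v \<noteq> C' v}"
  proof (rule finite_subset)
    show "{v \<in> VG. C v \<noteq> C' v} \<subseteq> {v \<in> VG. C v \<noteq> s0} \<union> {v \<in> VG. C' v \<noteq> s0}" by auto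
  qed (use assms a b in \<open>auto simp: lamplighter_def lamplighter_verts_def\<close>)
  \<comment> \<open>Induction on a finite superset \<open>T\<close> of the differing lamps, for all
    starting points: walk to \<open>z\<close>, set its lamp to \<open>C' z\<close>,
    continue.\<close>
  have "((C, x), (C', y)) \<in> (parcs L)\<^sup>*"
    if "(C, x) \<in> pverts L" "{v \<in> VG. C v \<noteq> C' v} \<subseteq> T" "finite T" for T C x
    using that(3,1,2)
  proof (induction T arbitrary: C x rule: finite_induct)
    case empty
    have "C v = C' v" for v
      using empty assms(2) b
      by (cases "v \<in> VG") (auto simp: lamplighter_def lamplighter_verts_def PiE_def extensional_def)
    then have "C = C'" by blast
    then show ?case
      using L_connected_position empty b assms(2)
      by (auto simp: lamplighter_def lamplighter_verts_def)
  next
    case (insert z T)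
    show ?case
    proof (cases "z \<in> VG")
      case True
      have t: "C' z \<in> VH"
        using True assms(2) b by (auto simp: lamplighter_def lamplighter_verts_def)
      have "((C, x), (C, z)) \<in> (parcs L)\<^sup>*"
        using L_connected_position insert True by blast
      moreover have zL: "(C, z) \<in> pverts L"
        using insert True by (auto simp: lamplighter_def lamplighter_verts_def)
      moreover have "((C, z), (C(z := C' z), z)) \<in> (parcs L)\<^sup>*"
        using L_connected_lamp[OF zL t] .
      moreover have "((C(z := C' z), z), (C', y)) \<in> (parcs L)\<^sup>*"
        using insert.prems by (intro insert.IH[OF L_upd[OF zL True t]]) auto
      ultimately show ?thesis by (meson rtrancl_trans)
    next
      case False
      then show ?thesis using insert by blast
    qed
  qed
  then show ?thesis using fin assms a b by blast
qed

section \<open>Averages over randomized lamps\<close>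

text \<open>The support of the law under which the lamps in \<open>D\<close> are independent and
  uniform and all others are as in \<open>C\<close>. For finite \<open>D\<close>, finite support is
  inherited from \<open>C\<close>, see \<open>confs_verts\<close>.\<close>

definition confs :: "('a \<Rightarrow> 'b) \<Rightarrow> 'a set \<Rightarrow> ('a \<Rightarrow> 'b) set" where
  "confs C D = {C' \<in> VG \<rightarrow>\<^sub>E VH. \<forall>v \<in> VG - D. C' v = C v}"

lemma confs_empty:
  assumes "C \<in> VG \<rightarrow>\<^sub>E VH"
  shows "confs C {} = {C}"
proof -
  have "C' = C" if "C' \<in> VG \<rightarrow>\<^sub>E VH" "\<forall>v \<in> VG. C' v = C v" for C'
    using that assms by (intro extensionalityI[of _ VG]) (auto simp: PiE_def)
  then show ?thesis using assms by (auto simp: confs_def)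
qed

lemma confs_insert:
  assumes "x \<in> VG - D"
  shows "confs C (insert x D) = (\<Union>t\<in>VH. confs (C(x := t)) D)"
proof
  show "confs C (insert x D) \<subseteq> (\<Union>t\<in>VH. confs (C(x := t)) D)"
  proof
    fix C' assume "C' \<in> confs C (insert x D)"
    then have "C' x \<in> VH" "C' \<in> confs (C(x := C' x)) D"
      using assms by (auto simp: confs_def)
    then show "C' \<in> (\<Union>t\<in>VH. confs (C(x := t)) D)" by blast
  qed
  show "(\<Union>t\<in>VH. confs (C(x := t)) D) \<subseteq> confs C (insert x D)"
    using assms by (auto simp: confs_def split: if_splits)
qed

lemma finite_confs:
  assumes "finite D" "C \<in> VG \<rightarrow>\<^sub>E VH" "D \<subseteq> VG"
  shows "finite (confs C D)"
  using assms
proof (induction D arbitrary: C rule: finite_induct)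
  case (insert x D)
  have "finite (confs (C(x := t)) D)" if "t \<in> VH" for t
    using insert that by (intro insert.IH) (auto simp: PiE_def extensional_def Pi_def)
  then show ?case using confs_insert[of x D C] insert finite_VH by auto
qed (simp add: confs_empty)

lemma sum_confs_insert:
  assumes "finite D" "C \<in> VG \<rightarrow>\<^sub>E VH" "insert x D \<subseteq> VG" "x \<notin> D"
  shows "(\<Sum>C' \<in> confs C (insert x D). f C') = (\<Sum>t\<in>VH. \<Sum>C' \<in> confs (C(x := t)) D. f C')"
proof -
  have x: "x \<in> VG - D" using assms by auto
  have "finite (confs (C(x := t)) D)" if "t \<in> VH" for t
    using assms that by (intro finite_confs) (auto simp: PiE_def extensional_def Pi_def)
  moreover have "confs (C(x := s)) D \<inter> confs (C(x := t)) D = {}" if "s \<noteq> t" for s t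
    using x that by (force simp: confs_def)
  ultimately show ?thesis
    unfolding confs_insert[OF x] using finite_VH by (intro sum.UNION_disjoint) auto
qed

lemma card_confs:
  assumes "finite D" "C \<in> VG \<rightarrow>\<^sub>E VH" "D \<subseteq> VG"
  shows "card (confs C D) = card VH ^ card D"
  using assms
proof (induction D arbitrary: C rule: finite_induct)
  case (insert x D)
  have "card (confs (C(x := t)) D) = card VH ^ card D" if "t \<in> VH" for t
    using insert that by (intro insert.IH) (auto simp: PiE_def extensional_def Pi_def)
  then show ?case
    using sum_confs_insert[of D C x "\<lambda>_. 1 :: nat"] insert by simp
qed (simp add: confs_empty)

lemma confs_verts:
  assumes "(C, x) \<in> pverts L" "finite D" "C' \<in> confs C D" "y \<in> VG"
  shows "(C', y) \<in> pverts L"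
proof -
  have "{v \<in> VG. C' v \<noteq> s0} \<subseteq> D \<union> {v \<in> VG. C v \<noteq> s0}" using assms(3) by (auto simp: confs_def)
  then have "finite {v \<in> VG. C' v \<noteq> s0}"
    by (rule finite_subset) (use assms in \<open>auto simp: lamplighter_def lamplighter_verts_def\<close>)
  then show ?thesis using assms by (auto simp: lamplighter_def lamplighter_verts_def confs_def)
qed

text \<open>When \<open>s\<close> and \<open>t\<close> are adjacent in \<open>H\<close>, this
  matching pairs configurations joined by a switch at \<open>x\<close>.\<close>

lemma bij_betw_confs_upd:
  assumes "x \<in> VG - D" "s \<in> VH" "t \<in> VH"
  shows "bij_betw (\<lambda>C'. C'(x := t)) (confs (C(x := s)) D) (confs (C(x := t)) D)"
proof (rule bij_betw_byWitness[where f' = "\<lambda>C'. C'(x := s)"])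
  show "\<forall>C'\<in>confs (C(x := s)) D. (C'(x := t))(x := s) = C'"
       "\<forall>C'\<in>confs (C(x := t)) D. (C'(x := s))(x := t) = C'"
    using assms by (auto simp: confs_def fun_eq_iff)
  show "(\<lambda>C'. C'(x := t)) ` confs (C(x := s)) D \<subseteq> confs (C(x := t)) D"
       "(\<lambda>C'. C'(x := s)) ` confs (C(x := t)) D \<subseteq> confs (C(x := s)) D"
    using assms by (auto simp: confs_def PiE_def extensional_def Pi_def)
qed

text \<open>For finite \<open>Z\<close>, twice the Dirichlet energy of the subgraph induced on
  \<open>Z\<close>, since both orientations of an edge are summed.\<close>

definition energy :: "(('a \<Rightarrow> 'b) \<times> 'a \<Rightarrow> real) \<Rightarrow> (('a \<Rightarrow> 'b) \<times> 'a) set \<Rightarrow> real" where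
  "energy \<phi> Z = (\<Sum>(a, b) \<in> parcs L \<inter> Z \<times> Z. (\<phi> a - \<phi> b)\<^sup>2)"

text \<open>The expectation of \<open>\<phi>\<close> at position \<open>x\<close> under the uniform
  law on \<open>confs C D\<close>; the denominator is its cardinality by
  \<open>card_confs\<close>.\<close>

definition avg :: "(('a \<Rightarrow> 'b) \<times> 'a \<Rightarrow> real) \<Rightarrow> ('a \<Rightarrow> 'b) \<Rightarrow> 'a set \<Rightarrow> 'a \<Rightarrow> real" where
  "avg \<phi> C D x = (\<Sum>C' \<in> confs C D. \<phi> (C', x)) / real (card VH) ^ card D"

lemma energy_nonneg: "0 \<le> energy \<phi> Z"
  unfolding energy_def by (intro sum_nonneg) auto

text \<open>Cauchy--Schwarz; the arcs are distinct, so their squared differences sum to at most the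
  energy. Dividing by \<open>card I\<close> leaves the gain
  \<open>1 / sqrt (card I)\<close>.\<close>

lemma abs_sum_diff_le_energy:
  assumes "finite I" "finite Z" and inj: "inj_on (\<lambda>i. (g i, g' i)) I"
    and arcs: "\<And>i. i \<in> I \<Longrightarrow> (g i, g' i) \<in> parcs L \<inter> Z \<times> Z"
  shows "\<bar>\<Sum>i\<in>I. \<phi> (g i) - \<phi> (g' i)\<bar> \<le> sqrt (real (card I)) * sqrt (energy \<phi> Z)"
proof -
  have "(\<Sum>i\<in>I. (\<phi> (g i) - \<phi> (g' i))\<^sup>2) = (\<Sum>(a, b) \<in> (\<lambda>i. (g i, g' i)) ` I. (\<phi> a - \<phi> b)\<^sup>2)"
    by (subst sum.reindex[OF inj]) simp
  also have "\<dots> \<le> energy \<phi> Z"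
    unfolding energy_def using assms by (intro sum_mono2) auto
  finally have le: "(\<Sum>i\<in>I. (\<phi> (g i) - \<phi> (g' i))\<^sup>2) \<le> energy \<phi> Z" .
  have "(\<Sum>i\<in>I. \<phi> (g i) - \<phi> (g' i))\<^sup>2 \<le> (\<Sum>i\<in>I. (\<phi> (g i) - \<phi> (g' i))\<^sup>2) * real (card I)"
    by (rule sum_squared_le_sum_of_squares)
  also have "\<dots> \<le> energy \<phi> Z * real (card I)"
    using le by (rule mult_right_mono) simp
  finally have "(\<Sum>i\<in>I. \<phi> (g i) - \<phi> (g' i))\<^sup>2 \<le> real (card I) * energy \<phi> Z"
    by (simp add: mult.commute)
  then have "sqrt ((\<Sum>i\<in>I. \<phi> (g i) - \<phi> (g' i))\<^sup>2) \<le> sqrt (real (card I) * energy \<phi> Z)"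
    by (rule real_sqrt_le_mono)
  then show ?thesis by (simp add: real_sqrt_mult)
qed

text \<open>\<open>81/100\<close> is an upper bound for \<open>1 / sqrt 2\<close> that is the square of a rational number.\<close>

lemma abs_divide_card_power_le:
  assumes "\<bar>S\<bar> \<le> sqrt (real (card VH ^ n)) * e" "0 \<le> e"
  shows "\<bar>S / real (card VH) ^ n\<bar> \<le> e * (81/100) ^ n"
proof -
  let ?h = "real (card VH)"
  have h: "2 \<le> ?h" using card_VH by simp
  have "1 / sqrt ?h \<le> 1 / sqrt 2" using h by (simp add: frac_le)
  also have "1 / sqrt 2 \<le> 81 / (100::real)"
    using real_le_rsqrt[of "100/81" 2] by (simp add: field_simps power2_eq_square)
  finally have r: "1 / sqrt ?h \<le> 81/100" .
  have "\<bar>S / ?h ^ n\<bar> \<le> sqrt (?h ^ n) * e / ?h ^ n"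
    using assms h by (simp add: divide_right_mono)
  also have "\<dots> = e * (sqrt (?h ^ n) / ?h ^ n)" by simp
  also have "sqrt (?h ^ n) / ?h ^ n = 1 / sqrt (?h ^ n)"
    by (simp add: sqrt_divide_self_eq inverse_eq_divide)
  also have "1 / sqrt (?h ^ n) = (1 / sqrt ?h) ^ n" by (simp add: real_sqrt_power power_one_over)
  also have "e * (1 / sqrt ?h) ^ n \<le> e * (81/100) ^ n"
    using r h assms(2) by (intro mult_left_mono power_mono) auto
  finally show ?thesis .
qed

section \<open>How moves, switches and randomizations change the mean\<close>

lemma avg_empty:
  assumes "(C, x) \<in> pverts L"
  shows "avg \<phi> C {} x = \<phi> (C, x)"
  using assms by (simp add: avg_def confs_empty lamplighter_def lamplighter_verts_def)

lemma confs_base_in_PiE: "(C, z) \<in> pverts L \<Longrightarrow> C \<in> VG \<rightarrow>\<^sub>E VH"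
  by (simp add: lamplighter_def lamplighter_verts_def)

text \<open>A move keeps all lamps, so each configuration in \<open>confs C D\<close> contributes
  its own arc with equal weight.\<close>

lemma avg_move:
  assumes C: "(C, z) \<in> pverts L" and D: "finite D" "D \<subseteq> VG" and xy: "(x, y) \<in> parcs G"
    and Z: "finite Z" "confs C D \<times> {x, y} \<subseteq> Z"
  shows "\<bar>avg \<phi> C D x - avg \<phi> C D y\<bar> \<le> sqrt (energy \<phi> Z) * (81/100) ^ card D"
proof -
  note CE = confs_base_in_PiE[OF C]
  have "((C', x), (C', y)) \<in> parcs L \<inter> Z \<times> Z" if "C' \<in> confs C D" for C'
    using L_move[OF confs_verts[OF C D(1) that] xy] xy G_sub that Z by auto
  then have "\<bar>\<Sum>C'\<in>confs C D. \<phi> (C', x) - \<phi> (C', y)\<bar>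
      \<le> sqrt (real (card (confs C D))) * sqrt (energy \<phi> Z)"
    using finite_confs[OF D(1) CE D(2)] Z by (intro abs_sum_diff_le_energy) (auto simp: inj_on_def)
  then have "\<bar>(\<Sum>C'\<in>confs C D. \<phi> (C', x) - \<phi> (C', y)) / real (card VH) ^ card D\<bar>
      \<le> sqrt (energy \<phi> Z) * (81/100) ^ card D"
    unfolding card_confs[OF D(1) CE D(2)] using energy_nonneg by (intro abs_divide_card_power_le) auto
  then show ?thesis by (simp add: avg_def sum_subtractf diff_divide_distrib)
qed

text \<open>The same estimate along the switching arcs from \<open>C'\<close> to
  \<open>C'(x := t)\<close>, which match the two supports.\<close>

lemma avg_switch_arc:
  assumes C: "(C, z) \<in> pverts L" and D: "finite D" "D \<subseteq> VG" and x: "x \<in> VG - D"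
    and st: "(s, t) \<in> parcs H" and Z: "finite Z" "confs C (insert x D) \<times> {x} \<subseteq> Z"
  shows "\<bar>avg \<phi> (C(x := s)) D x - avg \<phi> (C(x := t)) D x\<bar> \<le> sqrt (energy \<phi> Z) * (81/100) ^ card D"
proof -
  have s: "s \<in> VH" and t: "t \<in> VH" using st H_sub by auto
  let ?I = "confs (C(x := s)) D"
  have Cs: "(C(x := s), z) \<in> pverts L" using L_upd C x s by blast
  note CE = confs_base_in_PiE[OF Cs]
  have arc: "((C', x), (C'(x := t), x)) \<in> parcs L \<inter> Z \<times> Z" if C': "C' \<in> ?I" for C'
  proof -
    have "(C', x) \<in> pverts L" using confs_verts[OF Cs D(1) C'] x by blast
    moreover have "C' x = s" using C' x by (simp add: confs_def)
    ultimately have "((C', x), (C'(x := t), x)) \<in> parcs L" using L_switch st by blast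
    moreover have "C'(x := t) \<in> confs (C(x := t)) D"
      using bij_betw_confs_upd[OF x s t] C' by (auto simp: bij_betw_def)
    ultimately show ?thesis using C' Z s t confs_insert[OF x] by blast
  qed
  have fin: "finite ?I" using finite_confs[OF D(1) CE D(2)] .
  have "\<bar>\<Sum>C'\<in>?I. \<phi> (C', x) - \<phi> (C'(x := t), x)\<bar> \<le> sqrt (real (card ?I)) * sqrt (energy \<phi> Z)"
    by (rule abs_sum_diff_le_energy[where g = "\<lambda>C'. (C', x)" and g' = "\<lambda>C'. (C'(x := t), x)"])
      (use fin Z arc in \<open>auto simp: inj_on_def\<close>)
  then have "\<bar>(\<Sum>C'\<in>?I. \<phi> (C', x) - \<phi> (C'(x := t), x)) / real (card VH) ^ card D\<bar>
      \<le> sqrt (energy \<phi> Z) * (81/100) ^ card D"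
    unfolding card_confs[OF D(1) CE D(2)] using energy_nonneg by (intro abs_divide_card_power_le) auto
  moreover have "(\<Sum>C'\<in>?I. \<phi> (C'(x := t), x)) = (\<Sum>C'\<in>confs (C(x := t)) D. \<phi> (C', x))"
    by (rule sum.reindex_bij_betw[OF bij_betw_confs_upd[OF x s t]])
  ultimately show ?thesis by (simp add: avg_def sum_subtractf diff_divide_distrib)
qed

lemma avg_switch:
  assumes C: "(C, z) \<in> pverts L" and D: "finite D" "D \<subseteq> VG" and x: "x \<in> VG - D"
    and st: "s \<in> VH" "t \<in> VH" and Z: "finite Z" "confs C (insert x D) \<times> {x} \<subseteq> Z"
  shows "\<bar>avg \<phi> (C(x := s)) D x - avg \<phi> (C(x := t)) D x\<bar>
    \<le> real (card (parcs H)) * (sqrt (energy \<phi> Z) * (81/100) ^ card D)"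
proof -
  let ?e = "sqrt (energy \<phi> Z) * (81/100) ^ card D"
  have e: "0 \<le> ?e" using energy_nonneg by simp
  have "(s, t) \<in> (parcs H)\<^sup>*"
    using connected_imp_rtrancl[OF bidirected_H connected_H st] .
  \<comment> \<open>Connectedness of the finite graph \<open>H\<close> bounds the number of switches
    by its number of arcs; each switch is then charged separately.\<close>
  then obtain n where n: "n \<le> card (parcs H)" "(s, t) \<in> parcs H ^^ n"
    unfolding rtrancl_finite_eq_relpow[OF H.pair_finite_arcs] by auto
  have "\<bar>avg \<phi> (C(x := s)) D x - avg \<phi> (C(x := t)) D x\<bar> \<le> real n * ?e"
    using n(2)
  proof (induction n arbitrary: t)
    case (Suc n)
    then obtain t' where t': "(s, t') \<in> parcs H ^^ n" "(t', t) \<in> parcs H" by auto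
    have "real (Suc n) * ?e = real n * ?e + ?e" by (simp add: algebra_simps)
    then show ?case
      using Suc.IH[OF t'(1)] avg_switch_arc[OF C D x t'(2) Z, of \<phi>] by linarith
  qed simp
  also have "\<dots> \<le> real (card (parcs H)) * ?e" using n e by (intro mult_right_mono) auto
  finally show ?thesis .
qed

lemma avg_insert:
  assumes "(C, z) \<in> pverts L" "finite D" "insert x D \<subseteq> VG" "x \<notin> D"
  shows "avg \<phi> C (insert x D) x = (\<Sum>t\<in>VH. avg \<phi> (C(x := t)) D x) / card VH"
  using assms(2,4) sum_confs_insert[OF assms(2) confs_base_in_PiE[OF assms(1)] assms(3,4), of "\<lambda>C'. \<phi> (C', x)"]
  unfolding avg_def sum_divide_distrib[symmetric] by (simp add: mult.commute del: fun_upd_apply)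

lemma avg_randomize:
  assumes C: "(C, z) \<in> pverts L" and D: "finite D" "insert x D \<subseteq> VG"
    and Z: "finite Z" "confs C (insert x D) \<times> {x} \<subseteq> Z"
  shows "\<bar>avg \<phi> C D x - avg \<phi> C (insert x D) x\<bar>
    \<le> real (card (parcs H)) * (sqrt (energy \<phi> Z) * (81/100) ^ card D)" (is "_ \<le> ?B")
proof (cases "x \<in> D")
  case True
  then show ?thesis using energy_nonneg by (simp add: insert_absorb)
next
  case False
  have x: "x \<in> VG - D" and DV: "D \<subseteq> VG" using D False by auto
  \<comment> \<open>Since \<open>C\<close> is \<open>C(x := C x)\<close>, every difference below
    compares two fixed states of the lamp at \<open>x\<close>; the randomized mean averages over
    \<open>t\<close>.\<close>
  have Cx: "C x \<in> VH" using confs_base_in_PiE[OF C] x by auto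
  have h: "real (card VH) > 0" using card_VH by simp
  have "\<bar>\<Sum>t\<in>VH. avg \<phi> C D x - avg \<phi> (C(x := t)) D x\<bar> \<le> (\<Sum>t\<in>VH. ?B)"
    using avg_switch[OF C D(1) DV x Cx _ Z, of _ \<phi>]
    by (intro order.trans[OF sum_abs] sum_mono) simp
  then have "\<bar>(\<Sum>t\<in>VH. avg \<phi> C D x - avg \<phi> (C(x := t)) D x) / card VH\<bar> \<le> ?B"
    using h by (simp add: field_simps)
  moreover have "(\<Sum>t\<in>VH. avg \<phi> C D x - avg \<phi> (C(x := t)) D x) / card VH
      = avg \<phi> C D x - avg \<phi> C (insert x D) x"
    unfolding avg_insert[OF C D False] using h finite_VH by (auto simp: sum_subtractf diff_divide_distrib)
  ultimately show ?thesis by simp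
qed

text \<open>Any two states of a lamp are at most \<open>card (parcs H)\<close> switches apart; one more unit pays for the move.\<close>

abbreviation "step_cost \<equiv> real (card (parcs H)) + 1"

lemma avg_step:
  assumes C: "(C, z) \<in> pverts L" and D: "finite D" "D \<subseteq> VG" and xy: "(x, y) \<in> parcs G"
    and Z: "finite Z" "confs C (insert x D) \<times> {x, y} \<subseteq> Z"
  shows "\<bar>avg \<phi> C D x - avg \<phi> C (insert x D) y\<bar>
    \<le> step_cost * (sqrt (energy \<phi> Z) * (81/100) ^ card D)"
proof -
  have D': "finite (insert x D)" "insert x D \<subseteq> VG" using D xy G_sub by auto
  have "\<bar>avg \<phi> C (insert x D) x - avg \<phi> C (insert x D) y\<bar>
      \<le> sqrt (energy \<phi> Z) * (81/100) ^ card (insert x D)"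
    using avg_move[OF C D' xy Z] .
  \<comment> \<open>The lamp at \<open>x\<close> is randomized before the move, which can only
    improve the damping.\<close>
  also have "\<dots> \<le> sqrt (energy \<phi> Z) * (81/100) ^ card D"
    using D energy_nonneg
    by (intro mult_left_mono power_decreasing card_mono) auto
  finally show ?thesis
    using avg_randomize[OF C D(1) D'(2) Z(1), of \<phi>] Z(2)
    by (simp add: distrib_right subset_iff)
qed

section \<open>Walks that randomize the lamps they leave\<close>

text \<open>In a state \<open>(D, x)\<close>, the lamps in \<open>D\<close> are random and \<open>x\<close> is the position. The lamp at the final
  position of a walk is not randomized unless it was visited before.\<close>

definition walk_step :: "('a set \<times> 'a) rel" where
  "walk_step = {((D, x), (D', y)). D' = insert x D \<and> (x, y) \<in> parcs G}"

lemma walk_step_path: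
  assumes "\<And>i. i < n \<Longrightarrow> (p i, p (Suc i)) \<in> parcs G"
  shows "((D, p 0), (D \<union> p ` {..<n}, p n)) \<in> walk_step ^^ n"
  using assms
proof (induction n)
  case (Suc n)
  then have "((D, p 0), (D \<union> p ` {..<n}, p n)) \<in> walk_step ^^ n" by simp
  moreover have "((D \<union> p ` {..<n}, p n), (D \<union> p ` {..<Suc n}, p (Suc n))) \<in> walk_step"
    using Suc.prems by (simp add: walk_step_def lessThan_Suc)
  ultimately show ?case by (rule relpow_Suc_I)
qed simp

lemma walk_step_reverse_path:
  assumes "\<And>i. i < n \<Longrightarrow> (p i, p (Suc i)) \<in> parcs G"
  shows "((D, p n), (D \<union> p ` {0<..n}, p 0)) \<in> walk_step ^^ n"
proof -
  have "(p (n - i), p (n - Suc i)) \<in> parcs G" if "i < n" for i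
    using sym_G[OF assms[of "n - Suc i"]] that by (simp add: Suc_diff_Suc)
  then have "((D, p (n - 0)), (D \<union> (\<lambda>i. p (n - i)) ` {..<n}, p (n - n))) \<in> walk_step ^^ n"
    by (rule walk_step_path)
  moreover have "(\<lambda>i. p (n - i)) ` {..<n} = p ` {0<..n}"
  proof -
    have "(\<lambda>i. n - i) ` {..<n} = {0<..n}"
    proof (intro equalityI subsetI)
      fix j assume "j \<in> {0<..n}"
      then show "j \<in> (\<lambda>i. n - i) ` {..<n}" by (intro image_eqI[of _ _ "n - j"]) auto
    qed auto
    then show ?thesis by (metis image_image)
  qed
  ultimately show ?thesis by simp
qed

text \<open>The way out leaves every vertex but \<open>p n\<close>, the way back every one but
  \<open>p 0\<close>. For \<open>n = 0\<close> nothing would be left or randomized.\<close>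

lemma walk_step_loop:
  assumes "\<And>i. i < n \<Longrightarrow> (p i, p (Suc i)) \<in> parcs G" "0 < n"
  shows "((D, p 0), (D \<union> p ` {..n}, p 0)) \<in> walk_step ^^ (n + n)"
proof -
  have "((D, p 0), ((D \<union> p ` {..<n}) \<union> p ` {0<..n}, p 0)) \<in> walk_step ^^ (n + n)"
    using walk_step_path[of n p D] walk_step_reverse_path[of n p "D \<union> p ` {..<n}"] assms(1)
    unfolding relpow_add by blast
  moreover have "{..<n} \<union> {0<..n} = {..n}" using assms(2) by auto
  ultimately show ?thesis by (simp add: Un_assoc flip: image_Un)
qed

text \<open>Lets a tour step off a vertex, as a lamp is randomized only on leaving.\<close>

lemma neighbour_exists:
  assumes "infinite VG" "x \<in> VG"
  obtains y where "(x, y) \<in> parcs G"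
proof -
  obtain z where "z \<in> VG" "z \<noteq> x"
    using assms finite_subset[of VG "{x}"] by auto
  then have "(x, z) \<in> (parcs G)\<^sup>*" "x \<noteq> z"
    using connected_imp_rtrancl[OF bidirected_G connected_G assms(2)] by auto
  then show ?thesis using that by (auto elim: converse_rtranclE)
qed

text \<open>Visit the vertices of \<open>T\<close> one by one, stepping off each to a neighbour. The
  route does not depend on \<open>D\<close>, so it can follow any earlier walk.\<close>

lemma walk_step_tour:
  assumes "infinite VG" "finite T" "T \<subseteq> VG" "x \<in> VG" "y \<in> VG"
  shows "\<exists>n T'. T \<subseteq> T' \<and> (\<forall>D. ((D, x), (D \<union> T', y)) \<in> walk_step ^^ n)"
proof -
  have direct: "\<exists>n T'. \<forall>D. ((D, x), (D \<union> T', y)) \<in> walk_step ^^ n"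
    if x: "x \<in> VG" and y: "y \<in> VG" for x y
  proof -
    obtain n p where "p 0 = x" "p n = y" "\<And>i. i < n \<Longrightarrow> (p i, p (Suc i)) \<in> parcs G"
      using connected_imp_rtrancl[OF bidirected_G connected_G x y]
      by (auto simp: rtrancl_power relpow_fun_conv)
    then show ?thesis using walk_step_path[of n p] by blast
  qed
  show ?thesis
    using assms(2,3,4)
  proof (induction T arbitrary: x rule: finite_induct)
    case empty
    then show ?case using direct assms(5) by auto
  next
    case (insert t T)
    have t: "t \<in> VG" using insert by auto
    obtain w where w: "(t, w) \<in> parcs G" using neighbour_exists[OF assms(1) t] .
    obtain n1 T1 where 1: "\<And>D. ((D, x), (D \<union> T1, t)) \<in> walk_step ^^ n1"
      using direct[OF insert.prems(2) t] by blast
    obtain n2 T2 where 2: "T \<subseteq> T2" "\<And>D. ((D, w), (D \<union> T2, y)) \<in> walk_step ^^ n2"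
      using insert.IH[of w] insert.prems w G_sub by blast
    have "((D, x), (D \<union> insert t (T1 \<union> T2), y)) \<in> walk_step ^^ (Suc n1 + n2)" for D
    proof -
      have "((D \<union> T1, t), (insert t (D \<union> T1), w)) \<in> walk_step"
        using w by (simp add: walk_step_def)
      with 1[of D] have "((D, x), (insert t (D \<union> T1), w)) \<in> walk_step ^^ Suc n1"
        by (rule relpow_Suc_I)
      moreover have "((insert t (D \<union> T1), w), (insert t (D \<union> T1) \<union> T2, y)) \<in> walk_step ^^ n2"
        by (rule 2(2))
      ultimately have "((D, x), (insert t (D \<union> T1) \<union> T2, y)) \<in> walk_step ^^ (Suc n1 + n2)"
        unfolding relpow_add by blast
      moreover have "insert t (D \<union> T1) \<union> T2 = D \<union> insert t (T1 \<union> T2)" by blast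
      ultimately show ?thesis by simp
    qed
    then show ?case using 2(1) by (intro exI[of _ "Suc n1 + n2"] exI[of _ "insert t (T1 \<union> T2)"]) auto
  qed
qed

text \<open>The set of random lamps only grows, so no step costs more than the bound at the start;
  the induction carries this inclusion along.\<close>

lemma avg_walk:
  assumes C: "(C, z) \<in> pverts L"
    and W: "\<And>Z. finite Z \<Longrightarrow> energy \<phi> Z \<le> W"
    and D: "finite D" "D \<subseteq> VG"
    and walk: "((D, x), (D', y)) \<in> walk_step ^^ n"
  shows "\<bar>avg \<phi> C D x - avg \<phi> C D' y\<bar> \<le> real n * (step_cost * (sqrt W * (81/100) ^ card D))"
proof -
  have W0: "0 \<le> W" using W[of "{}"] by (simp add: energy_def)
  have "\<bar>avg \<phi> C D x - avg \<phi> C D' y\<bar> \<le> real n * (step_cost * (sqrt W * (81/100) ^ card D))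
      \<and> finite D' \<and> D \<subseteq> D' \<and> D' \<subseteq> VG"
    using walk
  proof (induction n arbitrary: D' y)
    case (Suc n)
    then obtain D1 x1 where 1: "((D, x), (D1, x1)) \<in> walk_step ^^ n" "D' = insert x1 D1" "(x1, y) \<in> parcs G"
      by (auto simp: walk_step_def)
    note IH = Suc.IH[OF 1(1)]
    have D1: "finite D1" "D1 \<subseteq> VG" "D \<subseteq> D1" using IH by auto
    let ?Z = "confs C (insert x1 D1) \<times> {x1, y}"
    have sub: "insert x1 D1 \<subseteq> VG" using D1 1(3) G_sub by auto
    have Z: "finite ?Z" using finite_confs[OF _ confs_base_in_PiE[OF C] sub] D1 by auto
    have "\<bar>avg \<phi> C D1 x1 - avg \<phi> C D' y\<bar> \<le> step_cost * (sqrt (energy \<phi> ?Z) * (81/100) ^ card D1)"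
      unfolding 1(2) using avg_step[OF C D1(1,2) 1(3) Z] by simp
    also have "\<dots> \<le> step_cost * (sqrt W * (81/100) ^ card D)"
      using W[OF Z] W0 D1 by (intro mult_left_mono mult_mono power_decreasing card_mono) auto
    finally show ?case using IH 1(2) sub by (auto simp: algebra_simps)
  qed (use D in simp)
  then show ?thesis by blast
qed

text \<open>By injectivity every step leaves a fresh lamp, so step \<open>i\<close> starts with
  exactly \<open>i\<close> random lamps.\<close>

lemma avg_path:
  assumes C: "(C, p 0) \<in> pverts L"
    and inj: "inj_on p {..N}" and path: "\<And>i. i < N \<Longrightarrow> (p i, p (Suc i)) \<in> parcs G"
    and e: "\<And>i. i < N \<Longrightarrow> energy \<phi> (confs C (p ` {..i}) \<times> {p i, p (Suc i)}) \<le> e i"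
  shows "\<bar>\<phi> (C, p 0) - avg \<phi> C (p ` {..<N}) (p N)\<bar> \<le> (\<Sum>i<N. step_cost * (sqrt (e i) * (81/100) ^ i))"
proof -
  have "\<bar>\<phi> (C, p 0) - avg \<phi> C (p ` {..<n}) (p n)\<bar> \<le> (\<Sum>i<n. step_cost * (sqrt (e i) * (81/100) ^ i))"
    if "n \<le> N" for n
    using that
  proof (induction n)
    case 0
    then show ?case using avg_empty[OF C] by simp
  next
    case (Suc n)
    let ?D = "p ` {..<n}"
    let ?Z = "confs C (p ` {..n}) \<times> {p n, p (Suc n)}"
    have ins: "p ` {..<Suc n} = insert (p n) ?D" "p ` {..n} = insert (p n) ?D"
      by (auto simp: lessThan_Suc lessThan_Suc_atMost[symmetric])
    have "p i \<in> VG" if "i \<le> n" for i using path[of i] that Suc.prems G_sub by auto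
    then have pV: "p ` {..n} \<subseteq> VG" by auto
    then have D: "finite ?D" "?D \<subseteq> VG" by auto
    have Z: "finite ?Z" using finite_confs[OF _ confs_base_in_PiE[OF C] pV] by auto
    have card: "card ?D = n"
      using inj Suc.prems by (subst card_image) (auto intro: inj_on_subset)
    have "\<bar>avg \<phi> C ?D (p n) - avg \<phi> C (p ` {..<Suc n}) (p (Suc n))\<bar>
        \<le> step_cost * (sqrt (energy \<phi> ?Z) * (81/100) ^ card ?D)"
      unfolding ins(1) using Suc.prems ins(2)
      by (intro avg_step[OF C D path Z]) auto
    also have "\<dots> \<le> step_cost * (sqrt (e n) * (81/100) ^ n)"
      unfolding card using e[of n] Suc.prems by (intro mult_left_mono mult_right_mono) auto
    finally show ?case using Suc by auto
  qed
  then show ?thesis by blast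
qed

section \<open>Convergence at infinity\<close>

text \<open>If a short path from \<open>(C, p 0)\<close> meets an end of \<open>E\<close>, then
  \<open>(C, p 0)\<close> arises from that end by moving at most \<open>n\<close> steps and changing
  lamps within distance \<open>n\<close>. By local finiteness only finitely many vertices arise
  so.\<close>

lemma far_from_finite_arc_set:
  assumes "finite E"
  shows "\<exists>F. finite F \<and> (\<forall>C p i. (C, p 0) \<in> pverts L - F \<longrightarrow> i < n \<longrightarrow>
    (\<forall>j\<le>i. (p j, p (Suc j)) \<in> parcs G) \<longrightarrow>
    (confs C (p ` {..i}) \<times> {p i, p (Suc i)}) \<inter> Field E = {})"
proof -
  let ?B = "\<lambda>x. \<Union>k\<le>n. {y. (x, y) \<in> parcs G ^^ k}"
  have finB: "finite (?B x)" and subB: "?B x \<subseteq> VG" if x: "x \<in> VG" for x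
  proof -
    show "finite (?B x)"
      using finite_relpow_image[OF finite_neighbours[OF locally_finite_G] G_sub x] by auto
    have "y \<in> VG" if "(x, y) \<in> parcs G ^^ k" for y k
      using that x G_sub by (cases k) auto
    then show "?B x \<subseteq> VG" by blast
  qed
  define F where "F = (\<Union>(C, x) \<in> Field E \<inter> pverts L. confs C (?B x) \<times> ?B x)"
  have "finite (confs C (?B x) \<times> ?B x)" if "(C, x) \<in> pverts L" for C x
  proof -
    have x: "x \<in> VG" using that by (simp add: lamplighter_def lamplighter_verts_def)
    show ?thesis
      using finite_confs[OF finB[OF x] confs_base_in_PiE[OF that] subB[OF x]] finB[OF x] by blast
  qed
  then have finF: "finite F" unfolding F_def using assms by (auto simp: finite_Field)
  have disjoint: False
    if Cp: "(C, p 0) \<in> pverts L - F" and i: "i < n" and p: "\<And>j. j \<le> i \<Longrightarrow> (p j, p (Suc j)) \<in> parcs G"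
      and z: "(C', x) \<in> confs C (p ` {..i}) \<times> {p i, p (Suc i)}" "(C', x) \<in> Field E" for C p i C' x
  proof -
    have reverse_p: "(p b, p a) \<in> parcs G ^^ (b - a)" if "a \<le> b" "b \<le> Suc i" for a b
      unfolding relpow_fun_conv
    proof (intro exI[of _ "\<lambda>k. p (b - k)"] conjI allI impI)
      fix k assume "k < b - a"
      then show "(p (b - k), p (b - Suc k)) \<in> parcs G"
        using sym_G[OF p[of "b - Suc k"]] that by (simp add: Suc_diff_Suc)
    qed (use that in auto)
    obtain b where b: "x = p b" "i \<le> b" "b \<le> Suc i" using z(1) by auto
    \<comment> \<open>From \<open>x = p b\<close> the path runs back to \<open>p a\<close> in
      \<open>b - a\<close> steps, at most \<open>n\<close> because \<open>b \<le> Suc i\<close> and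
      \<open>i < n\<close>.\<close>
    have pB: "p a \<in> ?B x" if "a \<le> i" for a
      by (rule UN_I[of "b - a"]) (use reverse_p[of a b] b that i in auto)
    have x: "x \<in> VG" using z(1) p[of i] G_sub by auto
    have "p j \<in> VG" if "j \<le> i" for j using p[OF that] G_sub by auto
    then have "p ` {..i} \<subseteq> VG" by auto
    then have C'L: "(C', x) \<in> pverts L"
      using confs_verts[of C "p 0" "p ` {..i}" C' x] Cp z(1) x by auto
    have "C w = C' w" if "w \<in> VG - ?B x" for w
    proof -
      have "w \<notin> p ` {..i}" using that pB by blast
      then show ?thesis using that z(1) by (simp add: confs_def)
    qed
    then have "C \<in> confs C' (?B x)"
      using confs_base_in_PiE[of C "p 0"] Cp unfolding confs_def by blast
    then have "(C, p 0) \<in> F"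
      unfolding F_def using z(2) C'L pB[of 0] by blast
    then show False using Cp by blast
  qed
  have "(confs C (p ` {..i}) \<times> {p i, p (Suc i)}) \<inter> Field E = {}"
    if "(C, p 0) \<in> pverts L - F" "i < n" "\<forall>j\<le>i. (p j, p (Suc j)) \<in> parcs G" for C p i
  proof (rule equals0I)
    fix z assume "z \<in> (confs C (p ` {..i}) \<times> {p i, p (Suc i)}) \<inter> Field E"
    then show False
      using disjoint[of C p i "fst z" "snd z"] that by (simp only: prod.collapse) blast
  qed
  with finF show ?thesis by (intro exI[of _ F]) simp
qed

text \<open>The factor 10 bounds the geometric series of ratio \<open>9/10\<close>. The further walk
  begins with \<open>N\<close> random lamps, whence its rate \<open>(81/100) ^ N\<close>.\<close>

lemma avg_path_walk:
  assumes W: "\<And>Z. finite Z \<Longrightarrow> energy \<phi> Z \<le> W" and \<eta>: "0 \<le> \<eta>" "sqrt W * (9/10) ^ n \<le> \<eta>"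
    and C: "(C, p 0) \<in> pverts L"
    and inj: "inj_on p {..N}" and path: "\<And>i. i < N \<Longrightarrow> (p i, p (Suc i)) \<in> parcs G"
    and early: "\<And>i. i < n \<Longrightarrow> i < N \<Longrightarrow> energy \<phi> (confs C (p ` {..i}) \<times> {p i, p (Suc i)}) \<le> \<eta>\<^sup>2"
    and walk: "((p ` {..<N}, p N), (D, z)) \<in> walk_step ^^ m"
  shows "\<bar>\<phi> (C, p 0) - avg \<phi> C D z\<bar> \<le>
    10 * step_cost * \<eta> + real m * (step_cost * (sqrt W * (81/100) ^ N))"
proof -
  have W0: "0 \<le> W" using W[of "{}"] by (simp add: energy_def)
  let ?e = "\<lambda>i. if i < n then \<eta>\<^sup>2 else W"
  have pV: "p i \<in> VG" if "i < N" for i using path[OF that] G_sub by auto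
  have e: "energy \<phi> (confs C (p ` {..i}) \<times> {p i, p (Suc i)}) \<le> ?e i" if i: "i < N" for i
  proof (cases "i < n")
    case False
    have "finite (confs C (p ` {..i}))"
      using i by (intro finite_confs confs_base_in_PiE[OF C]) (auto intro!: pV)
    then show ?thesis using W False by simp
  qed (use early i in simp)
  \<comment> \<open>\<open>81/100 = (9/10)\<^sup>2\<close>: half of the decay absorbs the large energy bound \<open>W\<close> of the late steps,
    the other half keeps the series summable.\<close>
  have term_le: "sqrt (?e i) * (81/100) ^ i \<le> \<eta> * (9/10) ^ i" for i
  proof (cases "i < n")
    case True
    have "(81/100 :: real) ^ i \<le> (9/10) ^ i" by (rule power_mono) auto
    then show ?thesis using True \<eta>(1) by (simp add: mult_left_mono)
  next
    case False
    have "sqrt W * (9/10) ^ i \<le> sqrt W * (9/10) ^ n"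
      using False W0 by (intro mult_left_mono power_decreasing) auto
    then have "(sqrt W * (9/10) ^ i) * (9/10) ^ i \<le> \<eta> * (9/10) ^ i"
      using \<eta>(2) by (intro mult_right_mono) auto
    moreover have "(81/100 :: real) ^ i = (9/10) ^ i * (9/10) ^ i"
      by (simp flip: power_mult_distrib)
    ultimately show ?thesis using False by (simp add: mult.assoc)
  qed
  have "(\<Sum>i<N. (9/10 :: real) ^ i) \<le> 10" by (simp add: sum_gp_strict)
  then have "\<eta> * (\<Sum>i<N. (9/10) ^ i) \<le> \<eta> * 10" using \<eta>(1) by (rule mult_left_mono)
  moreover have "(\<Sum>i<N. sqrt (?e i) * (81/100) ^ i) \<le> (\<Sum>i<N. \<eta> * (9/10) ^ i)"
    using term_le by (rule sum_mono)
  ultimately have "(\<Sum>i<N. sqrt (?e i) * (81/100) ^ i) \<le> 10 * \<eta>"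
    by (simp add: sum_distrib_left)
  then have "step_cost * (\<Sum>i<N. sqrt (?e i) * (81/100) ^ i) \<le> step_cost * (10 * \<eta>)"
    by (rule mult_left_mono) simp
  also have "\<dots> = 10 * step_cost * \<eta>" by simp
  finally have "\<bar>\<phi> (C, p 0) - avg \<phi> C (p ` {..<N}) (p N)\<bar> \<le> 10 * step_cost * \<eta>"
    using avg_path[OF C inj path e] unfolding sum_distrib_left[symmetric] by (rule order_trans[rotated])
  moreover have "card (p ` {..<N}) = N"
    using card_image[OF inj_on_subset[OF inj, of "{..<N}"]] by (simp add: subset_iff)
  moreover have "p ` {..<N} \<subseteq> VG" using pV by auto
  ultimately show ?thesis
    using avg_walk[OF C W _ _ walk] by simp
qed

lemma finite_verts_L:
  assumes "finite VG"
  shows "finite (pverts L)"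
proof (rule finite_subset)
  show "pverts L \<subseteq> (VG \<rightarrow>\<^sub>E VH) \<times> VG" by (auto simp: lamplighter_def lamplighter_verts_def)
  show "finite ((VG \<rightarrow>\<^sub>E VH) \<times> VG)" using assms finite_VH by (intro finite_cartesian_product finite_PiE) auto
qed

text \<open>Both starts are led to the same law at \<open>y\<close>, since \<open>?D\<close>
  contains every lamp in which \<open>C\<close> and \<open>C'\<close> differ. Each long path costs
  \<open>10 * step_cost * \<eta>\<close>; the tours cost nothing in the limit.\<close>

lemma avg_common_tour:
  assumes inf: "infinite VG"
    and W: "\<And>Z. finite Z \<Longrightarrow> energy \<phi> Z \<le> W" and \<eta>: "0 \<le> \<eta>" "sqrt W * (9/10) ^ n \<le> \<eta>"
    and u: "(C, x) \<in> pverts L" and v: "(C', y) \<in> pverts L"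
    and early: "\<And>p i. p 0 = x \<Longrightarrow> i < n \<Longrightarrow> (\<And>j. j \<le> i \<Longrightarrow> (p j, p (Suc j)) \<in> parcs G) \<Longrightarrow>
        energy \<phi> (confs C (p ` {..i}) \<times> {p i, p (Suc i)}) \<le> \<eta>\<^sup>2"
    and early': "\<And>p i. p 0 = y \<Longrightarrow> i < n \<Longrightarrow> (\<And>j. j \<le> i \<Longrightarrow> (p j, p (Suc j)) \<in> parcs G) \<Longrightarrow>
        energy \<phi> (confs C' (p ` {..i}) \<times> {p i, p (Suc i)}) \<le> \<eta>\<^sup>2"
  shows "\<bar>\<phi> (C, x) - \<phi> (C', y)\<bar> \<le> 20 * step_cost * \<eta>"
proof -
  have x: "x \<in> VG" and y: "y \<in> VG" using u v by (auto simp: lamplighter_def lamplighter_verts_def)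
  have W0: "0 \<le> W" using W[of "{}"] by (simp add: energy_def)
  let ?T = "{w \<in> VG. C w \<noteq> C' w}"
  have "?T \<subseteq> {w \<in> VG. C w \<noteq> s0} \<union> {w \<in> VG. C' w \<noteq> s0}" by auto
  then have fT: "finite ?T"
    by (rule finite_subset) (use u v in \<open>auto simp: lamplighter_def lamplighter_verts_def\<close>)
  obtain n1 T1 where T1: "?T \<subseteq> T1" "\<And>D. ((D, x), (D \<union> T1, y)) \<in> walk_step ^^ n1"
    using walk_step_tour[OF inf fT _ x y] by (metis (no_types, lifting) mem_Collect_eq subsetI)
  obtain n2 T2 where T2: "\<And>D. ((D, y), (D \<union> T2, x)) \<in> walk_step ^^ n2"
    using walk_step_tour[OF inf finite.emptyI empty_subsetI y x] by metis
  define c where "c = n2 + 2 * n1"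
  have bound: "\<bar>\<phi> (C, x) - \<phi> (C', y)\<bar> \<le> 20 * step_cost * \<eta> +
      2 * (real (3 * N + c) * (step_cost * (sqrt W * (81/100) ^ N)))" if N: "0 < N" for N
  proof -
    have nb: "\<And>x. x \<in> VG \<Longrightarrow> finite {y. (x, y) \<in> parcs G}"
      using finite_neighbours[OF locally_finite_G] .
    obtain p where p: "p 0 = x" "inj_on p {..N}" "\<And>i. i < N \<Longrightarrow> (p i, p (Suc i)) \<in> parcs G"
      using long_injective_path[OF nb G_sub inf x connected_imp_rtrancl[OF bidirected_G connected_G x]]
      by metis
    obtain q where q: "q 0 = y" "inj_on q {..N}" "\<And>i. i < N \<Longrightarrow> (q i, q (Suc i)) \<in> parcs G"
      using long_injective_path[OF nb G_sub inf y connected_imp_rtrancl[OF bidirected_G connected_G y]]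
      by metis
    \<comment> \<open>Walking back also leaves \<open>r N\<close>. For \<open>N = 0\<close> the two
      index ranges would miss the index 0.\<close>
    have return: "((r ` {..<N}, r N), (r ` {..N}, r 0)) \<in> walk_step ^^ N"
      if "\<And>i. i < N \<Longrightarrow> (r i, r (Suc i)) \<in> parcs G" for r
    proof -
      have "{..<N} \<union> {0<..N} = {..N}" using N by auto
      then show ?thesis
        using walk_step_reverse_path[of N r "r ` {..<N}"] that by (simp flip: image_Un)
    qed
    note loop_p = walk_step_loop[of N p, OF p(3) N, unfolded p(1)]
    note loop_q = walk_step_loop[of N q, OF q(3) N, unfolded q(1)]
    \<comment> \<open>From \<open>x\<close>: path and back, tour to \<open>y\<close>, loop along
      \<open>q\<close>, over to \<open>x\<close>, tour to \<open>y\<close> again. From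
      \<open>y\<close>: path and back, over to \<open>x\<close>, loop along \<open>p\<close>, tour
      to \<open>y\<close>. The last two legs of the first route add \<open>T2\<close>, so that both
      end with the same random set.\<close>
    let ?D = "p ` {..N} \<union> T1 \<union> q ` {..N} \<union> T2 \<union> T1"
    have walk_u: "((p ` {..<N}, p N), (?D, y)) \<in> walk_step ^^ (N + n1 + (N + N) + n2 + n1)"
      using return[of p] p T1(2) loop_q T2 unfolding relpow_add by blast
    have "((q ` {..<N}, q N), (q ` {..N} \<union> T2 \<union> p ` {..N} \<union> T1, y)) \<in> walk_step ^^ (N + n2 + (N + N) + n1)"
      using return[of q] q T2 loop_p T1(2) unfolding relpow_add by blast
    moreover have "q ` {..N} \<union> T2 \<union> p ` {..N} \<union> T1 = ?D" by blast
    ultimately have walk_v: "((q ` {..<N}, q N), (?D, y)) \<in> walk_step ^^ (N + n2 + (N + N) + n1)"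
      by simp
    let ?s = "step_cost * (sqrt W * (81/100) ^ N)"
    have s: "0 \<le> ?s" using W0 by simp
    have "\<bar>\<phi> (C, p 0) - avg \<phi> C ?D y\<bar> \<le> 10 * step_cost * \<eta> + real (N + n1 + (N + N) + n2 + n1) * ?s"
      by (rule avg_path_walk[OF W \<eta> _ p(2,3) early walk_u]) (use u p in auto)
    moreover have "real (N + n1 + (N + N) + n2 + n1) * ?s \<le> real (3 * N + c) * ?s"
      using s by (intro mult_right_mono) (auto simp: c_def)
    moreover have "\<bar>\<phi> (C', q 0) - avg \<phi> C' ?D y\<bar> \<le> 10 * step_cost * \<eta> + real (N + n2 + (N + N) + n1) * ?s"
      by (rule avg_path_walk[OF W \<eta> _ q(2,3) early' walk_v]) (use v q in auto)
    moreover have "real (N + n2 + (N + N) + n1) * ?s \<le> real (3 * N + c) * ?s"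
      using s by (intro mult_right_mono) (auto simp: c_def)
    moreover have "confs C ?D = confs C' ?D"
      using T1(1) by (fastforce simp: confs_def)
    then have "avg \<phi> C ?D y = avg \<phi> C' ?D y" by (simp add: avg_def)
    ultimately show ?thesis unfolding p(1) q(1) by linarith
  qed
  \<comment> \<open>The difference being estimated is independent of \<open>N\<close>, so
    \<open>N\<close> may tend to infinity.\<close>
  have 1: "(\<lambda>N. real N * (81/100 :: real) ^ N) \<longlonglongrightarrow> 0"
    using powser_times_n_limit_0[of "81/100 :: real"] by simp
  have 2: "(\<lambda>N. (81/100 :: real) ^ N) \<longlonglongrightarrow> 0"
    by (rule LIMSEQ_realpow_zero) auto
  have "(\<lambda>N. 20 * step_cost * \<eta> + 2 * step_cost * sqrt W *
      (3 * (real N * (81/100) ^ N) + real c * (81/100) ^ N)) \<longlonglongrightarrow>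
      20 * step_cost * \<eta> + 2 * step_cost * sqrt W * (3 * 0 + real c * 0)"
    by (intro tendsto_intros 1 2)
  moreover have "\<forall>N\<ge>1. \<bar>\<phi> (C, x) - \<phi> (C', y)\<bar> \<le> 20 * step_cost * \<eta> + 2 * step_cost * sqrt W *
      (3 * (real N * (81/100) ^ N) + real c * (81/100) ^ N)"
    using bound by (simp add: algebra_simps)
  ultimately show ?thesis by (auto dest: LIMSEQ_le_const)
qed

lemma finite_energy_convergent_at_infinity:
  assumes fin: "dirichlet_energy L \<phi> < \<infinity>" and "0 < \<epsilon>"
  shows "\<exists>F. finite F \<and> (\<forall>u \<in> pverts L - F. \<forall>v \<in> pverts L - F. \<bar>\<phi> u - \<phi> v\<bar> \<le> \<epsilon>)"
proof (cases "finite VG")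
  case True
  \<comment> \<open>The exceptional set may be all of the finite vertex set.\<close>
  then show ?thesis using finite_verts_L by (intro exI[of _ "pverts L"]) simp
next
  case inf: False
  let ?f = "\<lambda>(a, b). (\<phi> a - \<phi> b)\<^sup>2"
  obtain W where W: "\<And>Y. finite Y \<Longrightarrow> Y \<subseteq> parcs L \<Longrightarrow> sum ?f Y \<le> W"
    using finite_energy_bounded_sums[OF fin] by blast
  have eW: "energy \<phi> Z \<le> W" if "finite Z" for Z
    unfolding energy_def using that by (intro W) auto
  \<comment> \<open>Order of choices: \<open>\<eta>\<close> from \<open>\<epsilon>\<close>,
    \<open>n\<close> from \<open>\<eta>\<close> and \<open>W\<close>, \<open>E\<close> from
    \<open>\<eta>\<close>, and \<open>F\<close> from \<open>E\<close> and \<open>n\<close>.\<close>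
  define \<eta> where "\<eta> = \<epsilon> / (20 * step_cost)"
  have \<eta>: "0 < \<eta>" "20 * step_cost * \<eta> = \<epsilon>" using \<open>0 < \<epsilon>\<close> by (auto simp: \<eta>_def)
  have "(\<lambda>n. sqrt W * (9/10 :: real) ^ n) \<longlonglongrightarrow> sqrt W * 0"
    by (intro tendsto_mult tendsto_const LIMSEQ_realpow_zero) auto
  then have "\<forall>\<^sub>F n in sequentially. sqrt W * (9/10) ^ n < \<eta>"
    using \<eta>(1) by (intro order_tendstoD) auto
  then obtain n where n: "sqrt W * (9/10) ^ n \<le> \<eta>"
    by (auto simp: eventually_sequentially intro: less_imp_le)
  \<comment> \<open>The tail bound is \<open>\<eta>\<^sup>2\<close> because a step costs the square
    root of the energy.\<close>
  obtain E where E: "finite E" "\<And>Y. finite Y \<Longrightarrow> Y \<subseteq> parcs L - E \<Longrightarrow> sum ?f Y \<le> \<eta>\<^sup>2"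
    using finite_sums_tail[OF W zero_less_power[OF \<eta>(1)]] by metis
  obtain F where F: "finite F"
    "\<And>C p i. (C, p 0) \<in> pverts L - F \<Longrightarrow> i < n \<Longrightarrow> (\<And>j. j \<le> i \<Longrightarrow> (p j, p (Suc j)) \<in> parcs G) \<Longrightarrow>
      (confs C (p ` {..i}) \<times> {p i, p (Suc i)}) \<inter> Field E = {}"
    using far_from_finite_arc_set[OF E(1), of n] by metis
  have early: "energy \<phi> (confs C (p ` {..i}) \<times> {p i, p (Suc i)}) \<le> \<eta>\<^sup>2"
    if "(C, p 0) \<in> pverts L - F" "i < n" "\<And>j. j \<le> i \<Longrightarrow> (p j, p (Suc j)) \<in> parcs G" for C p i
  proof -
    let ?Z = "confs C (p ` {..i}) \<times> {p i, p (Suc i)}"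
    have "p ` {..i} \<subseteq> VG" using that(3) G_sub by auto
    then have "finite (confs C (p ` {..i}))"
      using that(1) by (intro finite_confs confs_base_in_PiE[of C "p 0"]) auto
    then have "finite (parcs L \<inter> ?Z \<times> ?Z)" by auto
    \<comment> \<open>An arc of \<open>E\<close> has its ends in \<open>Field E\<close>, which
      \<open>?Z\<close> avoids.\<close>
    moreover have "parcs L \<inter> ?Z \<times> ?Z \<subseteq> parcs L - E"
      using F(2)[OF that] by (blast intro: FieldI1)
    ultimately show ?thesis unfolding energy_def by (rule E(2))
  qed
  have "\<bar>\<phi> (C, x) - \<phi> (C', y)\<bar> \<le> \<epsilon>"
    if "(C, x) \<in> pverts L - F" "(C', y) \<in> pverts L - F" for C x C' y
    unfolding \<eta>(2)[symmetric]
    by (rule avg_common_tour[OF inf eW _ n]) (use that \<eta>(1) early in auto)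
  then show ?thesis using F(1) by (intro exI[of _ F]) auto
qed

end

section \<open>Harmonic functions of finite energy\<close>

theorem theorem1p1:
  fixes G :: "'a pair_pre_digraph"
    and H :: "'b pair_pre_digraph"
    and s0 :: 'b
    and \<phi> :: "('a \<Rightarrow> 'b) \<times> 'a \<Rightarrow> real"
  assumes "pair_bidirected_digraph G"
    and "Digraph_Component.connected (with_proj G)"
    and "locally_finite G"
    and "pair_graph H"
    and "Digraph_Component.connected (with_proj H)"
    and "parcs H \<noteq> {}"
    and "s0 \<in> pverts H"
    and "harmonic (lamplighter G H s0) \<phi>"
    and "dirichlet_energy (lamplighter G H s0) \<phi> < \<infinity>"
  shows "\<phi> constant_on pverts (lamplighter G H s0)"
proof -
  interpret lamplighter_graph G H s0
    by (rule lamplighter_graph.intro) (fact assms)+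
  show ?thesis
    using harmonic_convergent_at_infinity_constant[OF
        locally_finite_lamplighter[OF assms(3) finite_VH] assms(8) L_sub L_connected]
      finite_energy_convergent_at_infinity[OF assms(9)] by blast
qed

end
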